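(* Let $(\Omega,\mu)$ be a probability space, let $p\ne q$ be real numbers, let $f$ be a measurable function on $\Omega$ with $0<\langle|f|^p\rangle<\infty$ and $0<\langle|f|^q\rangle<\infty$, let $0<\sigma<1$, and let $$A_{q,p}=\{|f|\ge\sigma\,s_{q,p}\},\qquad s_{q,p}=\frac{\langle|f|^q\rangle^{\frac1{q-p}}}{\langle|f|^p\rangle^{\frac1{q-p}}}.$$ If $p>0$, then $\mu(A_{q,p})\le\sigma^{-p}V_{q,p}$. If $p<q$, then $$(1-\sigma^{q-p})\langle|f|^q\rangle\le\langle|f|^q\chi_{A_{q,p}}\rangle.$$
   Context: $\langle g\rangle=\int_\Omega g\,d\mu$; $\chi_A$ is the indicator function of $A$; $|f|^0=1$ and $0^r=+\infty$ for $r<0$. The $(q,p)$-volume factor of $f$ is $V_{q,p}=\langle|f|^q\rangle^{\frac{p}{p-q}}\big/\langle|f|^p\rangle^{\frac{q}{p-q}}$. *)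

theory Defs
  imports "HOL-Probability.Probability"
begin

text \<open>
  Real powers of a nonnegative real, with values in \<open>[0, \<infinity>]\<close>. Not just \<open>powr\<close>, because
  \<open>0 powr r = 0\<close> for every \<open>r\<close>, whereas here \<open>0\<^sup>0 = 1\<close> and \<open>0\<^sup>r = \<infinity>\<close> for \<open>r < 0\<close>.
\<close>
definition epowr :: "real \<Rightarrow> real \<Rightarrow> ennreal" where
  "epowr x r =
     (if r = 0 then 1 else if x = 0 \<and> r < 0 then \<infinity> else ennreal (x powr r))"

definition mean :: "'a measure \<Rightarrow> ('a \<Rightarrow> ennreal) \<Rightarrow> ennreal" where
  "mean M g = (\<integral>\<^sup>+ x. g x \<partial>M)"

definition moment :: "'a measure \<Rightarrow> real \<Rightarrow> ('a \<Rightarrow> 'b::real_normed_field) \<Rightarrow> ennreal" where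
  "moment M r f = mean M (\<lambda>x. epowr (norm (f x)) r)"

text \<open>
  The two quantities below are only meaningful if both moments are positive and finite;
  then \<open>enn2real\<close> loses no information and \<open>powr\<close> is the usual power of a positive real.
\<close>
definition volume_factor ::
    "'a measure \<Rightarrow> real \<Rightarrow> real \<Rightarrow> ('a \<Rightarrow> 'b::real_normed_field) \<Rightarrow> real" where
  "volume_factor M q p f =
     enn2real (moment M q f) powr (p / (p - q)) / enn2real (moment M p f) powr (q / (p - q))"

definition scale_factor ::
    "'a measure \<Rightarrow> real \<Rightarrow> real \<Rightarrow> ('a \<Rightarrow> 'b::real_normed_field) \<Rightarrow> real" where
  "scale_factor M q p f =
     enn2real (moment M q f) powr (1 / (q - p)) / enn2real (moment M p f) powr (1 / (q - p))"

definition level_set ::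
    "'a measure \<Rightarrow> real \<Rightarrow> real \<Rightarrow> real \<Rightarrow> ('a \<Rightarrow> 'b::real_normed_field) \<Rightarrow> 'a set" where
  "level_set M \<sigma> q p f = {x \<in> space M. norm (f x) \<ge> \<sigma> * scale_factor M q p f}"

end

theory Submission
  imports Defs
begin

text \<open>
  The scale \<open>s\<close> is chosen so that \<open>s powr (q - p)\<close> is exactly the ratio of the moments
  \<open>\<langle>|f|^q\<rangle> / \<langle>|f|^p\<rangle>\<close>. Both claims come from comparing powers of \<open>|f|\<close> with powers of the
  threshold \<open>t = \<sigma> * s\<close> and integrating. On the level set, \<open>t powr p \<le> |f|^p\<close> for positive \<open>p\<close>;
  this is Markov's inequality (\<open>moment_Markov\<close>), and \<open>\<langle>|f|^p\<rangle> * s powr (- p)\<close> is the volume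
  factor. Off the level set, for \<open>p < q\<close>, one has \<open>|f|^q \<le> t powr (q - p) * |f|^p\<close>, so this part of the
  \<open>q\<close>-th moment is at most \<open>\<sigma> powr (q - p) * s powr (q - p) * \<langle>|f|^p\<rangle>\<close>
  (\<open>moment_tail_below\<close>). By the choice of \<open>s\<close> that is \<open>\<sigma> powr (q - p) * \<langle>|f|^q\<rangle>\<close>, and the rest of the
  moment must lie on the level set.
\<close>

lemma epowr_measurable [measurable]:
  assumes [measurable]: "g \<in> borel_measurable M"
  shows "(\<lambda>x. epowr (g x) r) \<in> borel_measurable M"
  unfolding epowr_def by measurable

lemma epowr_pos: "0 < x \<Longrightarrow> epowr x r = ennreal (x powr r)"
  by (simp add: epowr_def)

text \<open>
  For \<open>x = 0\<close> the conventions for \<open>epowr\<close> decide the inequality: if \<open>p < 0\<close> the right-hand side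
  is infinite because \<open>t\<close> is positive, and otherwise \<open>q > 0\<close> makes the left-hand side vanish.
\<close>
lemma epowr_le_of_less:
  assumes "0 \<le> x" "x < t" "p < q"
  shows "epowr x q \<le> ennreal (t powr (q - p)) * epowr x p"
proof (cases "x = 0")
  case True
  have "0 < t powr (q - p)" using assms by simp
  with True assms show ?thesis
    by (cases "p < 0") (auto simp: epowr_def ennreal_mult_top)
next
  case False
  then have "0 < x" using assms by simp
  then have "x powr q = x powr (q - p) * x powr p"
    by (simp flip: powr_add)
  also have "\<dots> \<le> t powr (q - p) * x powr p"
    using assms by (intro mult_right_mono powr_mono2) auto
  finally have "ennreal (x powr q) \<le> ennreal (t powr (q - p)) * ennreal (x powr p)"
    by (simp add: ennreal_mult[symmetric] ennreal_leI)
  with \<open>0 < x\<close> show ?thesis by (simp only: epowr_pos)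
qed

lemma moment_Markov:
  fixes f :: "'a \<Rightarrow> 'b::real_normed_field"
  assumes [measurable]: "f \<in> borel_measurable M" and "0 < p" "0 < t"
  shows "ennreal (t powr p) * emeasure M {x \<in> space M. t \<le> norm (f x)} \<le> moment M p f"
proof -
  have "ennreal (t powr p) * emeasure M {x \<in> space M. t \<le> norm (f x)}
      = (\<integral>\<^sup>+ x. ennreal (t powr p) * indicator {x \<in> space M. t \<le> norm (f x)} x \<partial>M)"
    by (rule nn_integral_cmult_indicator[symmetric]) measurable
  also have "\<dots> \<le> moment M p f"
    unfolding moment_def mean_def
  proof (rule nn_integral_mono)
    fix x
    show "ennreal (t powr p) * indicator {x \<in> space M. t \<le> norm (f x)} x \<le> epowr (norm (f x)) p"
      using assms by (auto simp: epowr_def indicator_def intro!: ennreal_leI powr_mono2)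
  qed
  finally show ?thesis .
qed

lemma moment_tail_below:
  fixes f :: "'a \<Rightarrow> 'b::real_normed_field"
  assumes [measurable]: "f \<in> borel_measurable M" and "p < q"
  shows "mean M (\<lambda>x. epowr (norm (f x)) q * indicator {x \<in> space M. norm (f x) < t} x)
    \<le> ennreal (t powr (q - p)) * moment M p f"
proof -
  have "mean M (\<lambda>x. epowr (norm (f x)) q * indicator {x \<in> space M. norm (f x) < t} x)
      \<le> (\<integral>\<^sup>+ x. ennreal (t powr (q - p)) * epowr (norm (f x)) p \<partial>M)"
    unfolding mean_def
    using epowr_le_of_less[OF norm_ge_zero _ assms(2)]
    by (intro nn_integral_mono) (auto simp: indicator_def)
  also have "\<dots> = ennreal (t powr (q - p)) * moment M p f"
    unfolding moment_def mean_def by (rule nn_integral_cmult) measurable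
  finally show ?thesis .
qed

lemma moment_split:
  fixes f :: "'a \<Rightarrow> 'b::real_normed_field"
  assumes [measurable]: "f \<in> borel_measurable M"
  shows "moment M q f =
      mean M (\<lambda>x. epowr (norm (f x)) q * indicator {x \<in> space M. t \<le> norm (f x)} x)
    + mean M (\<lambda>x. epowr (norm (f x)) q * indicator {x \<in> space M. norm (f x) < t} x)"
proof -
  have "moment M q f =
      (\<integral>\<^sup>+ x. epowr (norm (f x)) q * indicator {x \<in> space M. t \<le> norm (f x)} x
           + epowr (norm (f x)) q * indicator {x \<in> space M. norm (f x) < t} x \<partial>M)"
    unfolding moment_def mean_def
    by (intro nn_integral_cong) (auto simp: indicator_def)
  also have "\<dots> = (\<integral>\<^sup>+ x. epowr (norm (f x)) q * indicator {x \<in> space M. t \<le> norm (f x)} x \<partial>M)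
           + (\<integral>\<^sup>+ x. epowr (norm (f x)) q * indicator {x \<in> space M. norm (f x) < t} x \<partial>M)"
    by (rule nn_integral_add) measurable
  finally show ?thesis unfolding mean_def .
qed

lemma scale_factor_pos:
  assumes "0 < enn2real (moment M p f)" "0 < enn2real (moment M q f)"
  shows "0 < scale_factor M q p f"
  using assms unfolding scale_factor_def by (intro divide_pos_pos) auto

lemma scale_factor_powr_diff:
  assumes "p \<noteq> q" "0 < enn2real (moment M p f)" "0 < enn2real (moment M q f)"
  shows "scale_factor M q p f powr (q - p) * enn2real (moment M p f) = enn2real (moment M q f)"
  using assms unfolding scale_factor_def by (simp add: powr_divide powr_powr)

lemma volume_factor_eq_scale_factor:
  assumes "p \<noteq> q" "0 < enn2real (moment M p f)" "0 < enn2real (moment M q f)"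
  shows "volume_factor M q p f = enn2real (moment M p f) * scale_factor M q p f powr (- p)"
proof -
  define a b where "a = enn2real (moment M q f)" and "b = enn2real (moment M p f)"
  have ab: "0 < a" "0 < b" using assms by (auto simp: a_def b_def)
  have e1: "p / (p - q) = - (p / (q - p))" and e2: "- (q / (p - q)) = 1 + p / (q - p)"
    using assms(1) by (auto simp: field_simps)
  have "volume_factor M q p f = a powr (- (p / (q - p))) * b powr (1 + p / (q - p))"
    unfolding volume_factor_def a_def[symmetric] b_def[symmetric] e1[symmetric] e2[symmetric]
    by (simp only: powr_minus divide_inverse)
  also have "\<dots> = b * (a powr (- (p / (q - p))) * b powr (p / (q - p)))"
    using ab by (simp add: powr_add)
  also have "\<dots> = b * scale_factor M q p f powr (- p)"
    unfolding scale_factor_def a_def[symmetric] b_def[symmetric] using ab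
    by (simp add: powr_divide powr_powr powr_minus_divide)
  finally show ?thesis by (simp add: b_def)
qed

theorem mainTheorem10:
  fixes M :: "'a measure" and f :: "'a \<Rightarrow> 'b::real_normed_field" and p q \<sigma> :: real
  assumes "prob_space M"
    and "p \<noteq> q"
    and "f \<in> borel_measurable M"
    and "0 < moment M p f" and "moment M p f < \<infinity>"
    and "0 < moment M q f" and "moment M q f < \<infinity>"
    and "0 < \<sigma>" and "\<sigma> < 1"
  shows "(p > 0 \<longrightarrow>
            measure M (level_set M \<sigma> q p f) \<le> \<sigma> powr (- p) * volume_factor M q p f) \<and>
         (p < q \<longrightarrow>
            ennreal (1 - \<sigma> powr (q - p)) * moment M q f
              \<le> mean M (\<lambda>x. epowr (norm (f x)) q * indicator (level_set M \<sigma> q p f) x))"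
proof -
  interpret prob_space M by fact
  define s where "s = scale_factor M q p f"
  define a b where "a = enn2real (moment M q f)" and "b = enn2real (moment M p f)"
  have pos: "0 < a" "0 < b"
    using assms by (auto simp: a_def b_def enn2real_positive_iff)
  have a: "moment M q f = ennreal a" and b: "moment M p f = ennreal b"
    using assms by (auto simp: a_def b_def)
  have s: "0 < s" and diff: "s powr (q - p) * b = a"
    and vol: "volume_factor M q p f = b * s powr (- p)"
    using pos assms(2) unfolding s_def a_def b_def
    by (auto intro: scale_factor_pos scale_factor_powr_diff volume_factor_eq_scale_factor)
  have level: "level_set M \<sigma> q p f = {x \<in> space M. \<sigma> * s \<le> norm (f x)}"
    by (simp add: level_set_def s_def)
  have t: "0 < \<sigma> * s" using s assms by simp
  show ?thesis
  proof (intro conjI impI)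
    assume "p > 0"
    from moment_Markov[OF assms(3) this t]
    have "(\<sigma> * s) powr p * measure M (level_set M \<sigma> q p f) \<le> b"
      using pos unfolding level[symmetric] b
      by (simp add: emeasure_eq_measure ennreal_mult[symmetric])
    moreover have "0 < (\<sigma> * s) powr p"
      using s assms(8) by simp
    ultimately have "measure M (level_set M \<sigma> q p f) \<le> b / (\<sigma> * s) powr p"
      by (simp only: pos_le_divide_eq mult.commute)
    then have "measure M (level_set M \<sigma> q p f) \<le> b * (\<sigma> * s) powr (- p)"
      by (simp add: powr_minus_divide)
    then show "measure M (level_set M \<sigma> q p f) \<le> \<sigma> powr (- p) * volume_factor M q p f"
      using s assms(8) by (simp add: vol powr_mult mult_ac)
  next
    assume "p < q"
    let ?on = "mean M (\<lambda>x. epowr (norm (f x)) q * indicator (level_set M \<sigma> q p f) x)"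
    let ?off = "mean M (\<lambda>x. epowr (norm (f x)) q * indicator {x \<in> space M. norm (f x) < \<sigma> * s} x)"
    have "?off \<le> ennreal ((\<sigma> * s) powr (q - p)) * ennreal b"
      using moment_tail_below[OF assms(3) \<open>p < q\<close>, of "\<sigma> * s"] by (simp add: b)
    also have "\<dots> = ennreal (\<sigma> powr (q - p) * a)"
      using s assms(8) pos by (simp add: powr_mult ennreal_mult[symmetric] mult.assoc diff)
    finally have "?off \<le> ennreal (\<sigma> powr (q - p) * a)" .
    moreover have "ennreal a = ?on + ?off"
      using moment_split[OF assms(3), of q "\<sigma> * s"] unfolding a level .
    ultimately have "ennreal a \<le> ?on + ennreal (\<sigma> powr (q - p) * a)"
      by (simp only: add_left_mono)
    then have "ennreal a - ennreal (\<sigma> powr (q - p) * a) \<le> ?on"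
      by (simp add: ennreal_minus_le_iff add.commute)
    moreover have "\<sigma> powr (q - p) < 1"
      using powr_less_mono2[of "q - p" \<sigma> 1] assms(8,9) \<open>p < q\<close> by simp
    ultimately show "ennreal (1 - \<sigma> powr (q - p)) * moment M q f \<le> ?on"
      using pos by (simp add: a ennreal_minus ennreal_mult[symmetric] left_diff_distrib)
  qed
qed

end
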